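(* Let $G=(V,E,l)$ be a finite connected undirected simple metric graph, and let $v^*\in V$. Suppose that there exist two closed walks $C_1$ and $C_2$ based at $v^*$ whose metric lengths $A=l(C_1)$ and $B=l(C_2)$ satisfy $\frac{A}{B}\notin\mathbb Q$. Let $\tau_s(\varepsilon)$ be the moment of permanent $\varepsilon$-saturation of $\mathcal W(G,v^* )$ and $N_{A,B}(\varepsilon)$ the covering time of the rotation $R_{A,B}(x)=x+A\pmod B$. (i) Suppose that there exist constants $C>0$, $\gamma\ge1$, and $\varepsilon_0>0$ such that $N_{A,B}(\varepsilon)\le C\varepsilon^{-\gamma}$ for all $0<\varepsilon<\varepsilon_0$. Then there exists a constant $K>0$, depending on $G$, $v^*$, $A$, $B$, $C$, and $\gamma$, such that $\tau_s(\varepsilon)\le K\varepsilon^{-\gamma}$ for all sufficiently small $\varepsilon>0$. (ii) In particular, if the rotation $R_{A,B}$ has bounded type, then there exists a constant $K>0$ such that $\tau_s(\varepsilon)\le K\varepsilon^{-1}$ for all sufficiently small $\varepsilon>0$.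
   Context: A metric graph $G=(V,E,l)$ is a graph $(V,E)$ with a length function $l:E\to\mathbb R_{>0}$; each edge $e$ is identified with an interval of length $l(e)$. Graphs are undirected and simple (no loops, at most one edge between two vertices). Each edge $\{u,w\}$ gives two oriented edges $u\to w$ and $w\to u$. A walk is a finite sequence of vertices $(v_0,\dots,v_n)$ with $\{v_{i-1},v_i\}\in E$ for all $i$; its metric length is $\sum_{i=1}^n l(\{v_{i-1},v_i\})$. A closed walk based at $v^*$ is a walk with $v_0=v_n=v^*$. The dynamics $\mathcal W(G,v^* )$ (time $t\in\mathbb R_{\ge 0}$, space $V\cup\bigsqcup_{e\in E}e$, i.e. the metric graph): each moving point lies on an oriented edge and moves at unit speed toward its head. When a moving point reaches a vertex $v$, it is removed and new moving points are created at $v$, one on each oriented edge issuing from $v$ (including the reverse of the edge along which it arrived), each moving away from $v$ at unit speed. At time $0$ moving points are created at $v^*$ on all oriented edges issuing from $v^*$. The system is $\varepsilon$-saturated at time $t$ if the moving points at time $t$ form an $\varepsilon$-net of the metric graph (every point is within distance at most $\varepsilon$ of some moving point). The moment of permanent $\varepsilon$-saturation $\tau_s(\varepsilon)$ is the infimum of the maximal time interval, unbounded to the right, on which the system is $\varepsilon$-saturated; i.e. $\tau_s(\varepsilon)=\inf\{t_0\ge0:\mathcal W(G,v^* )\text{ is }\varepsilon\text{-saturated at every }t\ge t_0\}$ (with $\inf\emptyset=+\infty$). Covering time: for $A,B>0$ with $A/B\notin\mathbb Q$ and $N\ge1$, let $S_N(A,B)=\{nA \bmod B:0\le n\le N\}\subset\mathbb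 R/B\mathbb Z$. It has circular gaps at most $\delta$ if, after ordering its points cyclically on the circle $\mathbb R/B\mathbb Z$ of length $B$, every gap between adjacent points has length at most $\delta$. For $\delta>0$, $N_{A,B}(\delta)=\min\{N\ge1: S_N(A,B)\text{ has circular gaps at most }\delta\}$. The rotation $R_{A,B}$ has bounded type if the continued fraction partial quotients of the irrational number $A/B$ are bounded. *)

theory Defs
  imports
    "HOL-Library.Extended_Real"
    "HOL-Library.Indicator_Function"
    "HOL-Library.Real_Mod"
begin

section \<open>Metric graphs and walks\<close>

text \<open>Undirected simple graphs: an edge is a two-element set of vertices. The values of the
  length function outside the edge set are irrelevant.\<close>

locale finite_metric_graph =
  fixes V :: "'a set" and E :: "'a set set" and l :: "'a set \<Rightarrow> real"
  assumes finite_vertices: "finite V"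
    and edges: "\<And>e. e \<in> E \<Longrightarrow> e \<subseteq> V \<and> card e = 2"
    and length_pos: "\<And>e. e \<in> E \<Longrightarrow> l e > 0"

definition walk :: "'a set \<Rightarrow> 'a set set \<Rightarrow> 'a list \<Rightarrow> bool" where
  "walk V E vs \<longleftrightarrow> vs \<noteq> [] \<and> set vs \<subseteq> V \<and> successively (\<lambda>u w. {u, w} \<in> E) vs"

definition walk_between :: "'a set \<Rightarrow> 'a set set \<Rightarrow> 'a \<Rightarrow> 'a list \<Rightarrow> 'a \<Rightarrow> bool" where
  "walk_between V E u vs w \<longleftrightarrow> walk V E vs \<and> hd vs = u \<and> last vs = w"

definition closed_walk_at :: "'a set \<Rightarrow> 'a set set \<Rightarrow> 'a \<Rightarrow> 'a list \<Rightarrow> bool" where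
  "closed_walk_at V E v vs \<longleftrightarrow> walk_between V E v vs v"

definition walk_length :: "('a set \<Rightarrow> real) \<Rightarrow> 'a list \<Rightarrow> real" where
  "walk_length l vs = (\<Sum>i<length vs - 1. l {vs ! i, vs ! Suc i})"

definition graph_connected :: "'a set \<Rightarrow> 'a set set \<Rightarrow> bool" where
  "graph_connected V E \<longleftrightarrow> (\<forall>u\<in>V. \<forall>w\<in>V. \<exists>vs. walk_between V E u vs w)"


section \<open>The metric graph as a metric space\<close>

text \<open>The points are realised by their barycentric coordinates with respect to the
  vertices: \<^term>\<open>indicator {v}\<close> is the vertex \<^term>\<open>v\<close>, and \<open>edge_point l u w s\<close> is the point of
  the edge \<^term>\<open>{u, w}\<close> at distance \<^term>\<open>s\<close> from \<^term>\<open>u\<close>. In this way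
  \<open>edge_point l u w s\<close> and \<open>edge_point l w u (l {u, w} - s)\<close> are equal,
  and the endpoints of the edges are glued to the vertices.\<close>

definition edge_point :: "('a set \<Rightarrow> real) \<Rightarrow> 'a \<Rightarrow> 'a \<Rightarrow> real \<Rightarrow> 'a \<Rightarrow> real" where
  "edge_point l u w s =
     (\<lambda>x. (1 - s / l {u, w}) * indicator {u} x + s / l {u, w} * indicator {w} x)"

definition graph_points :: "'a set \<Rightarrow> 'a set set \<Rightarrow> ('a set \<Rightarrow> real) \<Rightarrow> ('a \<Rightarrow> real) set" where
  "graph_points V E l =
     {indicator {v} | v. v \<in> V} \<union>
     {edge_point l u w s | u w s. {u, w} \<in> E \<and> 0 \<le> s \<and> s \<le> l {u, w}}"

text \<open>\<open>segment_to_vertex V E l p u s\<close>: the point \<^term>\<open>p\<close> is joined to the vertex \<^term>\<open>u\<close> by a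
  segment of length \<^term>\<open>s\<close> inside a single edge (or \<^term>\<open>p\<close> is \<^term>\<open>u\<close> itself).\<close>

definition segment_to_vertex ::
    "'a set \<Rightarrow> 'a set set \<Rightarrow> ('a set \<Rightarrow> real) \<Rightarrow> ('a \<Rightarrow> real) \<Rightarrow> 'a \<Rightarrow> real \<Rightarrow> bool" where
  "segment_to_vertex V E l p u s \<longleftrightarrow>
     (u \<in> V \<and> p = indicator {u} \<and> s = 0) \<or>
     (\<exists>w. {u, w} \<in> E \<and> 0 \<le> s \<and> s \<le> l {u, w} \<and> p = edge_point l u w s)"

text \<open>The path metric. A path either stays inside one edge, or consists of a segment to a
  vertex, a walk, and a segment from a vertex.\<close>

definition path_lengths ::
    "'a set \<Rightarrow> 'a set set \<Rightarrow> ('a set \<Rightarrow> real) \<Rightarrow> ('a \<Rightarrow> real) \<Rightarrow> ('a \<Rightarrow> real) \<Rightarrow> real set" where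
  "path_lengths V E l p q =
     {\<bar>s - s'\<bar> | u w s s'. {u, w} \<in> E \<and> s \<in> {0..l {u, w}} \<and> s' \<in> {0..l {u, w}} \<and>
        p = edge_point l u w s \<and> q = edge_point l u w s'} \<union>
     {s + walk_length l vs + s' | u u' vs s s'. segment_to_vertex V E l p u s \<and>
        walk_between V E u vs u' \<and> segment_to_vertex V E l q u' s'}"

definition graph_dist ::
    "'a set \<Rightarrow> 'a set set \<Rightarrow> ('a set \<Rightarrow> real) \<Rightarrow> ('a \<Rightarrow> real) \<Rightarrow> ('a \<Rightarrow> real) \<Rightarrow> real" where
  "graph_dist V E l p q = Inf (path_lengths V E l p q)"


section \<open>The dynamics\<close>

text \<open>\<open>moving_point E l v t u w s\<close>: at time \<^term>\<open>t\<close> there is a moving point on the oriented edge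
  from \<^term>\<open>u\<close> to \<^term>\<open>w\<close>, at distance \<^term>\<open>s\<close> from the tail \<^term>\<open>u\<close>, in the system started at \<^term>\<open>v\<close>.
  The offset of a moving point is always less than the length of its edge: at the moment when
  it would equal that length, the point is removed and its successors appear with offset 0.
  Multiplicities of moving points are not recorded, saturation being a property of the set of
  their positions.\<close>

inductive moving_point ::
    "'a set set \<Rightarrow> ('a set \<Rightarrow> real) \<Rightarrow> 'a \<Rightarrow> real \<Rightarrow> 'a \<Rightarrow> 'a \<Rightarrow> real \<Rightarrow> bool"
  for E :: "'a set set" and l :: "'a set \<Rightarrow> real" and v :: 'a where
  start: "{v, w} \<in> E \<Longrightarrow> moving_point E l v 0 v w 0"
| move: "moving_point E l v t u w s \<Longrightarrow> 0 \<le> h \<Longrightarrow> s + h < l {u, w} \<Longrightarrow>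
    moving_point E l v (t + h) u w (s + h)"
| branch: "moving_point E l v t u w s \<Longrightarrow> {w, x} \<in> E \<Longrightarrow>
    moving_point E l v (t + (l {u, w} - s)) w x 0"

definition saturated_at ::
    "'a set \<Rightarrow> 'a set set \<Rightarrow> ('a set \<Rightarrow> real) \<Rightarrow> 'a \<Rightarrow> real \<Rightarrow> real \<Rightarrow> bool" where
  "saturated_at V E l v \<epsilon> t \<longleftrightarrow>
     (\<forall>p\<in>graph_points V E l. \<exists>u w s. moving_point E l v t u w s \<and>
        graph_dist V E l p (edge_point l u w s) \<le> \<epsilon>)"

text \<open>The infimum is taken in \<^typ>\<open>ereal\<close>, so that it is \<open>\<infinity>\<close> for the empty set.\<close>

definition saturation_time ::
    "'a set \<Rightarrow> 'a set set \<Rightarrow> ('a set \<Rightarrow> real) \<Rightarrow> 'a \<Rightarrow> real \<Rightarrow> ereal" where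
  "saturation_time V E l v \<epsilon> =
     Inf {ereal t\<^sub>0 | t\<^sub>0. 0 \<le> t\<^sub>0 \<and> (\<forall>t\<ge>t\<^sub>0. saturated_at V E l v \<epsilon> t)}"


section \<open>Rotations\<close>

text \<open>The circle \<open>\<real>/B\<int>\<close> is represented by the interval \<^term>\<open>{0..<B}\<close>.\<close>

definition rotation_orbit :: "real \<Rightarrow> real \<Rightarrow> nat \<Rightarrow> real set" where
  "rotation_orbit A B N = {(real n * A) rmod B | n. n \<le> N}"

text \<open>For a finite nonempty subset of the circle; the last gap is the one that wraps around.\<close>

definition circular_gaps_le :: "real \<Rightarrow> real set \<Rightarrow> real \<Rightarrow> bool" where
  "circular_gaps_le B S \<delta> \<longleftrightarrow>
     (let xs = sorted_list_of_set S in
        (\<forall>i. Suc i < length xs \<longrightarrow> xs ! Suc i - xs ! i \<le> \<delta>) \<and> hd xs + B - last xs \<le> \<delta>)"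

text \<open>For \<open>A, B, \<delta> > 0\<close> and irrational \<^term>\<open>A / B\<close> the minimum is taken over a nonempty set.\<close>

definition covering_time :: "real \<Rightarrow> real \<Rightarrow> real \<Rightarrow> nat" where
  "covering_time A B \<delta> = (LEAST N. N \<ge> 1 \<and> circular_gaps_le B (rotation_orbit A B N) \<delta>)"

text \<open>If \<^term>\<open>x\<close> is irrational, so are all its complete quotients, and the recursion never
  divides by zero.\<close>

primrec complete_quotient :: "real \<Rightarrow> nat \<Rightarrow> real" where
  "complete_quotient x 0 = x"
| "complete_quotient x (Suc n) = 1 / frac (complete_quotient x n)"

definition partial_quotient :: "real \<Rightarrow> nat \<Rightarrow> int" where
  "partial_quotient x n = \<lfloor>complete_quotient x n\<rfloor>"

definition rotation_bounded_type :: "real \<Rightarrow> real \<Rightarrow> bool" where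
  "rotation_bounded_type A B \<longleftrightarrow>
     A / B \<notin> \<rat> \<and> (\<exists>M. \<forall>n. \<bar>partial_quotient (A / B) n\<bar> \<le> M)"

end

theory Submission
  imports Defs
begin

text \<open>If \<open>d\<close> is the length of a walk from \<open>v\<close> to \<open>u\<close>, running around the two closed
  walks first shows that \<open>u\<close> emits moving points at all times \<open>d + n A + k B\<close> with natural
  \<open>n, k\<close>. At a late time \<open>t\<close> the point at distance \<open>s\<close> from \<open>u\<close> on an edge, where \<open>u\<close> is the nearer
  endpoint, is approximated by the moving point emitted at such a time in
  \<open>{t - s - \<epsilon>..<t - s}\<close>. This time exists with \<open>n \<le> N\<close>, the covering time, and then \<open>k > 0\<close>
  as soon as \<open>t\<close> exceeds \<open>N A\<close> plus a constant, so \<open>\<tau> \<le> D + N A\<close>. In the bounded type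
  case the orbit up to a convergent denominator \<open>q\<close> has gaps at most \<open>2 B / q\<close>, and
  consecutive denominators have bounded ratio.\<close>

section \<open>Gaps of finite subsets of the circle\<close>

text \<open>Among the lifts of \<open>S\<close> to the line, the largest one below \<open>y\<close>
  is at most one gap away. Conversely, since the bound by \<open>y\<close> is strict, taking
  \<open>y\<close> to be a lift of a point of \<open>S\<close> measures the gap to its
  predecessor.\<close>

lemma circular_gaps_le_iff:
  fixes S :: "real set"
  assumes fin: "finite S" and ne: "S \<noteq> {}" and sub: "S \<subseteq> {0..<B}"
  shows "circular_gaps_le B S \<delta> \<longleftrightarrow>
    (\<forall>y. \<exists>x\<in>S. \<exists>k::int. y - \<delta> \<le> x + of_int k * B \<and> x + of_int k * B < y)"
proof -
  define xs where "xs = sorted_list_of_set S"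
  have set_xs: "set xs = S" and sorted: "sorted xs" and strict: "sorted_wrt (<) xs"
    using fin by (auto simp: xs_def)
  have xs_ne: "xs \<noteq> []" using ne set_xs by auto
  have B: "B > 0" using ne sub by force
  have hd: "hd xs \<in> S" "\<And>x. x \<in> S \<Longrightarrow> hd xs \<le> x"
    using hd_in_set[OF xs_ne] xs_ne sorted set_xs by (cases xs; auto)+
  have last: "last xs \<in> S" "\<And>x. x \<in> S \<Longrightarrow> x \<le> last xs"
    using last_in_set[OF xs_ne] xs_ne sorted set_xs
    by (auto simp: last_conv_nth in_set_conv_nth[of _ xs] sorted_nth_mono)
  have shift: "of_int k * B \<le> -B" if "k < 0" for k :: int
    using that B mult_right_mono[of "of_int k" "-1" B] by simp
  have shift': "of_int k * B \<ge> B" if "k > 0" for k :: int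
    using that B mult_right_mono[of 1 "of_int k" B] by simp
  show ?thesis
  proof
    assume gaps: "circular_gaps_le B S \<delta>"
    show "\<forall>y. \<exists>x\<in>S. \<exists>k::int. y - \<delta> \<le> x + of_int k * B \<and> x + of_int k * B < y"
    proof
      fix y
      \<comment> \<open>Ceiling minus one, rather than floor, makes \<open>z\<close> lie strictly
        above \<open>hd xs\<close> and at most at \<open>hd xs + B\<close>, so some point of
        \<open>S\<close> is always strictly below \<open>z\<close>.\<close>
      define j where "j = \<lceil>(y - hd xs) / B\<rceil> - 1"
      define z where "z = y - of_int j * B"
      have "of_int j < (y - hd xs) / B" "(y - hd xs) / B \<le> of_int j + 1"
        unfolding j_def by linarith+
      hence z: "hd xs < z" "z \<le> hd xs + B"
        using B by (auto simp: z_def field_simps)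
      define T where "T = {x \<in> S. x < z}"
      have T: "finite T" "T \<noteq> {}" using fin hd z by (auto simp: T_def)
      define x where "x = Max T"
      have "x \<in> T" using T by (simp add: x_def)
      hence x: "x \<in> S" "x < z" by (auto simp: T_def)
      have x_max: "u \<le> x" if "u \<in> S" "u < z" for u
        using T that by (simp add: x_def T_def)
      obtain i where i: "i < length xs" "xs ! i = x"
        using x set_xs by (metis in_set_conv_nth)
      \<comment> \<open>The gap after \<open>x\<close> reaches at least up to \<open>z\<close>: it
        ends at the next point of \<open>S\<close>, or it is the wrap-around gap if \<open>x\<close>
        is the last point.\<close>
      have "z - \<delta> \<le> x"
      proof (cases "Suc i < length xs")
        case True
        hence "xs ! i < xs ! Suc i" using strict by (simp add: sorted_wrt_nth_less)
        hence "\<not> xs ! Suc i < z" using x_max[of "xs ! Suc i"] True i set_xs by (metis nth_mem not_le)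
        thus ?thesis using gaps True i
          by (force simp: circular_gaps_le_def Let_def xs_def[symmetric])
      next
        case False
        hence "i = length xs - 1" using i by simp
        hence "x = last xs" using i xs_ne by (simp add: last_conv_nth)
        thus ?thesis using gaps z by (simp add: circular_gaps_le_def Let_def xs_def[symmetric])
      qed
      thus "\<exists>x\<in>S. \<exists>k::int. y - \<delta> \<le> x + of_int k * B \<and> x + of_int k * B < y"
        using x by (intro bexI[of _ x] exI[of _ j]) (auto simp: z_def)
    qed
  next
    assume cov: "\<forall>y. \<exists>x\<in>S. \<exists>k::int. y - \<delta> \<le> x + of_int k * B \<and> x + of_int k * B < y"
    have "xs ! Suc i - xs ! i \<le> \<delta>" if i: "Suc i < length xs" for i
    proof -
      obtain x and k :: int where x: "x \<in> S" "xs ! Suc i - \<delta> \<le> x + of_int k * B"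
        "x + of_int k * B < xs ! Suc i" using cov by blast
      have in_S: "xs ! i \<in> S" "xs ! Suc i \<in> S" using i set_xs by auto
      \<comment> \<open>No lift lies strictly between neighbours: \<open>k < 0\<close> gives a
        negative number, \<open>k > 0\<close> a number at least \<open>B\<close>, and
        \<open>k = 0\<close> a point of smaller index.\<close>
      have "x + of_int k * B \<le> xs ! i"
      proof (cases k "0::int" rule: linorder_cases)
        case less
        moreover have "x < B" "0 \<le> xs ! i" using x in_S sub by auto
        ultimately show ?thesis using shift[of k] by linarith
      next
        case equal
        obtain m where m: "m < length xs" "xs ! m = x" using x set_xs by (metis in_set_conv_nth)
        have "m < Suc i"
          using m x equal i sorted by (metis add.right_neutral mult_zero_left not_le of_int_0 sorted_nth_mono)
        hence "xs ! m \<le> xs ! i" using i sorted by (simp add: sorted_nth_mono)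
        thus ?thesis using m equal by simp
      next
        case greater
        moreover have "0 \<le> x" "xs ! Suc i < B" using x in_S sub by auto
        ultimately show ?thesis using shift'[of k] x by linarith
      qed
      thus ?thesis using x by simp
    qed
    moreover have "hd xs + B - last xs \<le> \<delta>"
    proof -
      obtain x and k :: int where x: "x \<in> S" "hd xs + B - \<delta> \<le> x + of_int k * B"
        "x + of_int k * B < hd xs + B" using cov by blast
      have "\<not> k > 0" using x(3) shift'[of k] hd(2)[OF x(1)] by auto
      hence "of_int k * B \<le> 0" using B by (simp add: mult_nonpos_nonneg)
      thus ?thesis using last(2)[OF x(1)] x by simp
    qed
    ultimately show "circular_gaps_le B S \<delta>"
      by (simp add: circular_gaps_le_def Let_def xs_def[symmetric])
  qed
qed

text \<open>Reduction modulo \<open>B\<close> only adds an integer multiple of \<open>B\<close>,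
  which \<open>k\<close> absorbs. In this form the condition is visibly monotone in
  \<delta>.\<close>

lemma circular_gaps_le_rotation_orbit_iff:
  assumes "B > 0"
  shows "circular_gaps_le B (rotation_orbit A B N) \<delta> \<longleftrightarrow>
    (\<forall>y. \<exists>n\<le>N. \<exists>k::int. y - \<delta> \<le> real n * A + of_int k * B \<and> real n * A + of_int k * B < y)"
proof -
  have orbit: "rotation_orbit A B N = (\<lambda>n. (real n * A) rmod B) ` {..N}"
    by (auto simp: rotation_orbit_def)
  have sub: "rotation_orbit A B N \<subseteq> {0..<B}"
    using assms by (auto simp: orbit rmod_nonneg rmod_less)
  have "(\<exists>x\<in>rotation_orbit A B N. \<exists>k::int. y - \<delta> \<le> x + of_int k * B \<and> x + of_int k * B < y) \<longleftrightarrow>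
      (\<exists>n\<le>N. \<exists>k::int. y - \<delta> \<le> real n * A + of_int k * B \<and> real n * A + of_int k * B < y)" for y
  proof -
    have "(\<exists>k::int. y - \<delta> \<le> (r rmod B) + of_int k * B \<and> (r rmod B) + of_int k * B < y) \<longleftrightarrow>
        (\<exists>k::int. y - \<delta> \<le> r + of_int k * B \<and> r + of_int k * B < y)" (is "?L \<longleftrightarrow> ?R") for r
    proof -
      obtain m :: int where m: "r rmod B = r + of_int m * B"
        using assms by (intro that[of "- \<lfloor>r / B\<rfloor>"]) (simp add: rmod_def)
      show ?thesis
      proof
        assume ?L
        then obtain k :: int where "y - \<delta> \<le> (r rmod B) + of_int k * B" "(r rmod B) + of_int k * B < y"
          by blast
        thus ?R unfolding m by (intro exI[of _ "m + k"]) (simp add: algebra_simps)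
      next
        assume ?R
        then obtain k :: int where "y - \<delta> \<le> r + of_int k * B" "r + of_int k * B < y"
          by blast
        thus ?L unfolding m by (intro exI[of _ "k - m"]) (simp add: algebra_simps)
      qed
    qed
    thus ?thesis by (auto simp: orbit)
  qed
  moreover have "finite (rotation_orbit A B N)" "rotation_orbit A B N \<noteq> {}"
    by (auto simp: orbit)
  ultimately show ?thesis by (simp add: circular_gaps_le_iff sub)
qed


section \<open>Convergents and the covering time\<close>

text \<open>Indices are shifted by one: \<open>cf_num x (Suc k) / cf_den x (Suc k)\<close> is the \<open>k\<close>-th convergent.\<close>

fun cf_num :: "real \<Rightarrow> nat \<Rightarrow> int" where
  "cf_num x 0 = 1"
| "cf_num x (Suc 0) = partial_quotient x 0"
| "cf_num x (Suc (Suc n)) = partial_quotient x (Suc n) * cf_num x (Suc n) + cf_num x n"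

fun cf_den :: "real \<Rightarrow> nat \<Rightarrow> int" where
  "cf_den x 0 = 0"
| "cf_den x (Suc 0) = 1"
| "cf_den x (Suc (Suc n)) = partial_quotient x (Suc n) * cf_den x (Suc n) + cf_den x n"

section \<open>Convergents: growth of denominators, coprimality, approximation error\<close>

context
  fixes x :: real
  assumes irrational: "x \<notin> \<rat>"
begin

lemma complete_quotient_irrational: "complete_quotient x n \<notin> \<rat>"
proof (induction n)
  case 0
  show ?case using irrational by simp
next
  case (Suc n)
  show ?case
  proof
    assume "complete_quotient x (Suc n) \<in> \<rat>"
    hence "inverse (complete_quotient x (Suc n)) \<in> \<rat>" by (rule Rats_inverse)
    hence "frac (complete_quotient x n) + of_int \<lfloor>complete_quotient x n\<rfloor> \<in> \<rat>"
      by (intro Rats_add) auto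
    thus False using Suc by (simp add: frac_def)
  qed
qed

lemma frac_complete_quotient_pos: "frac (complete_quotient x n) > 0"
proof -
  have "frac (complete_quotient x n) \<noteq> 0"
    using complete_quotient_irrational[of n] Ints_subset_Rats by (auto simp: frac_eq_0_iff)
  thus ?thesis by (simp add: less_le)
qed

lemma complete_quotient_Suc_gt_1: "complete_quotient x (Suc n) > 1"
  using frac_complete_quotient_pos[of n] frac_lt_1[of "complete_quotient x n"] by simp

lemma complete_quotient_unfold:
  "complete_quotient x n = of_int (partial_quotient x n) + 1 / complete_quotient x (Suc n)"
  by (simp add: partial_quotient_def frac_def)

lemma partial_quotient_Suc_ge_1: "partial_quotient x (Suc n) \<ge> 1"
  using complete_quotient_Suc_gt_1[of n] by (simp add: partial_quotient_def le_floor_iff)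

lemma cf_den_bounds: "0 \<le> cf_den x n \<and> 1 \<le> cf_den x (Suc n) \<and> cf_den x n \<le> cf_den x (Suc n)"
proof (induction n)
  case (Suc n)
  have "cf_den x (Suc n) \<le> partial_quotient x (Suc n) * cf_den x (Suc n)"
    using mult_right_mono[OF partial_quotient_Suc_ge_1[of n], of "cf_den x (Suc n)"] Suc by simp
  hence "cf_den x (Suc n) \<le> cf_den x (Suc (Suc n))" using Suc by (simp only: cf_den.simps) linarith
  thus ?case using Suc by (simp del: cf_den.simps)
qed simp

text \<open>From \<open>n = 1\<close> on, each step adds an earlier denominator that is at least 1.
  This crude growth suffices to make the denominators unbounded.\<close>

lemma cf_den_Suc_ge: "int n \<le> cf_den x (Suc n)"
proof (induction n)
  case (Suc n)
  have "cf_den x (Suc n) \<le> partial_quotient x (Suc n) * cf_den x (Suc n)"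
    using mult_right_mono[OF partial_quotient_Suc_ge_1[of n], of "cf_den x (Suc n)"]
      cf_den_bounds[of n] by simp
  hence "cf_den x (Suc n) + cf_den x n \<le> cf_den x (Suc (Suc n))" by simp
  moreover have "cf_den x n \<ge> 1" if "n > 0"
    using cf_den_bounds[of "n - 1"] that by simp
  ultimately show ?case using Suc cf_den_bounds[of n] cf_den_bounds[of "Suc n"]
    by (cases "n = 0") (simp_all del: cf_den.simps(3))
qed simp

text \<open>One step of the recursion adds a multiple of one column to the other and swaps them,
  which flips the sign of the determinant.\<close>

lemma cf_det: "cf_num x (Suc n) * cf_den x n - cf_num x n * cf_den x (Suc n) = (-1) ^ Suc n"
proof (induction n)
  case (Suc n)
  have "cf_num x (Suc (Suc n)) * cf_den x (Suc n) - cf_num x (Suc n) * cf_den x (Suc (Suc n)) =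
      - (cf_num x (Suc n) * cf_den x n - cf_num x n * cf_den x (Suc n))"
    by (simp add: algebra_simps)
  thus ?case unfolding Suc by simp
qed simp

lemma coprime_cf: "coprime (cf_num x (Suc n)) (cf_den x (Suc n))"
proof (rule coprimeI)
  fix d assume "d dvd cf_num x (Suc n)" "d dvd cf_den x (Suc n)"
  hence "d dvd cf_num x (Suc n) * cf_den x n - cf_num x n * cf_den x (Suc n)" by simp
  thus "is_unit d" unfolding cf_det by (metis dvd_mult_unit_iff is_unit_power_iff dvd_minus_iff
      dvd_refl minus_one_mult_self dvd_triv_left dvd_trans)
qed

text \<open>\<open>x\<close> is a Moebius image of its complete quotient, here with denominators
  cleared. For the induction, substitute \<open>y = a + 1 / z\<close> and multiply by
  \<open>z\<close>.\<close>

lemma cf_complete_quotient: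
  "x * (complete_quotient x (Suc n) * of_int (cf_den x (Suc n)) + of_int (cf_den x n)) =
     complete_quotient x (Suc n) * of_int (cf_num x (Suc n)) + of_int (cf_num x n)"
proof (induction n)
  case 0
  show ?case using complete_quotient_unfold[of 0] complete_quotient_Suc_gt_1[of 0]
    by (simp add: field_simps del: complete_quotient.simps(2))
next
  case (Suc n)
  define y z a where "y = complete_quotient x (Suc n)" "z = complete_quotient x (Suc (Suc n))"
    "a = partial_quotient x (Suc n)"
  have z: "z > 1" and y: "y = of_int a + 1 / z"
    using complete_quotient_Suc_gt_1[of "Suc n"] complete_quotient_unfold[of "Suc n"]
    by (simp_all only: y_z_a_def)
  have "z * (x * (y * of_int (cf_den x (Suc n)) + of_int (cf_den x n))) =
      z * (y * of_int (cf_num x (Suc n)) + of_int (cf_num x n))"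
    using Suc by (simp only: y_z_a_def)
  moreover have "z * y = z * of_int a + 1" using z y by (simp add: field_simps)
  ultimately have "x * (z * (of_int a * of_int (cf_den x (Suc n)) + of_int (cf_den x n))
      + of_int (cf_den x (Suc n))) =
      z * (of_int a * of_int (cf_num x (Suc n)) + of_int (cf_num x n)) + of_int (cf_num x (Suc n))"
    by algebra
  thus ?case by (simp add: y_z_a_def del: complete_quotient.simps)
qed

text \<open>By the determinant identity the error is exactly \<open>1 / (y * q + q')\<close>, where
  the complete quotient \<open>y\<close> exceeds 1.\<close>

lemma cf_approx:
  "\<bar>of_int (cf_den x (Suc n)) * x - of_int (cf_num x (Suc n))\<bar> < 1 / of_int (cf_den x (Suc n))"
proof -
  define y p p' q q' :: real where defs: "y = complete_quotient x (Suc n)" "p = of_int (cf_num x (Suc n))"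
    "p' = of_int (cf_num x n)" "q = of_int (cf_den x (Suc n))" "q' = of_int (cf_den x n)"
  have y: "y > 1" using complete_quotient_Suc_gt_1[of n] by (simp only: defs)
  have q: "q \<ge> 1" "q' \<ge> 0" using cf_den_bounds[of n] by (simp_all add: defs)
  have "q < y * q" using y q by simp
  hence D: "q < y * q + q'" using q(2) by linarith
  have "p * q' - p' * q = (-1) ^ Suc n"
    using cf_det[of n, THEN arg_cong, of real_of_int] by (simp add: defs)
  moreover have "x * (y * q + q') = y * p + p'"
    using cf_complete_quotient[of n] by (simp only: defs)
  hence "(q * x - p) * (y * q + q') = - (p * q' - p' * q)" by algebra
  ultimately have "\<bar>q * x - p\<bar> * (y * q + q') = 1"
    using D q by (metis abs_minus_cancel abs_mult abs_of_pos abs_power_minus abs_1 power_one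
        less_trans less_le_trans zero_less_one)
  hence "\<bar>q * x - p\<bar> = 1 / (y * q + q')" using D q by (simp add: field_simps)
  also have "\<dots> < 1 / q" using D q by (simp add: frac_less2)
  finally show ?thesis by (simp only: defs)
qed

end

text \<open>For \<open>n < q\<close> the point \<open>n x\<close> is displaced from \<open>n p / q\<close> by less than \<open>1 / q\<close>, always in
  the same direction, and the points \<open>n p / q\<close> run through all multiples of \<open>1 / q\<close> modulo 1.\<close>

lemma rational_approx_covers:
  fixes x y :: real and p q :: int
  assumes "coprime p q" "q \<ge> 1" and approx: "\<bar>of_int q * x - of_int p\<bar> < 1 / of_int q"
  shows "\<exists>n::nat. int n < q \<and>
    (\<exists>k::int. y - 2 / of_int q \<le> real n * x + of_int k \<and> real n * x + of_int k < y)"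
proof -
  define err where "err = of_int q * x - of_int p"
  \<comment> \<open>If the displacement pushes points upwards, the target is lowered by
    \<open>1 / q\<close> in advance, so that the displaced point stays below
    \<open>y\<close>.\<close>
  define z where "z = (if err \<ge> 0 then y - 1 / of_int q else y)"
  define m where "m = \<lceil>z * of_int q\<rceil> - 1"
  have q: "real_of_int q > 0" using assms by simp
  have "of_int m < z * of_int q" "z * of_int q \<le> of_int m + 1" unfolding m_def by linarith+
  hence m: "of_int m / of_int q < z" "z - 1 / of_int q \<le> of_int m / of_int q"
    using q by (simp_all add: pos_divide_less_eq pos_le_divide_eq left_diff_distrib)
  \<comment> \<open>\<open>u\<close> inverts \<open>p\<close> modulo \<open>q\<close>, so the
    residue of \<open>u * m\<close> is the index whose multiple of \<open>p / q\<close> is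
    \<open>m / q\<close> modulo 1.\<close>
  obtain u v where uv: "u * p + v * q = 1"
    using assms(1) by (metis bezout_int coprime_imp_gcd_eq_1)
  define n where "n = nat ((u * m) mod q)"
  have n: "int n = (u * m) mod q" "int n < q" using assms(2) by (auto simp: n_def)
  have "int n * p = u * m * p - q * ((u * m) div q) * p"
    unfolding n by (metis minus_mult_div_eq_mod left_diff_distrib)
  also have "\<dots> = m - q * (v * m + (u * m) div q * p)" using uv by algebra
  finally have "int n * p + q * (v * m + (u * m) div q * p) = m" by simp
  then obtain k where k: "int n * p + q * k = m" by blast
  define t where "t = real n * err / of_int q"
  have "of_int m = real n * of_int p + of_int q * of_int k"
    using k[symmetric] by simp
  hence eq: "real n * x + of_int k = of_int m / of_int q + t"
    using q by (simp add: t_def err_def field_simps)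
  have nq: "real n / of_int q < 1" "real n / of_int q \<ge> 0" using n(2) q by (simp_all add: divide_less_eq)
  have "\<bar>t\<bar> = real n / of_int q * \<bar>err\<bar>" using q by (simp add: t_def abs_mult)
  also have "\<dots> \<le> \<bar>err\<bar>" using nq by (intro mult_left_le_one_le) auto
  also have "\<dots> < 1 / of_int q" using approx by (simp add: err_def)
  finally have t: "\<bar>t\<bar> < 1 / of_int q" .
  have sign: "if err \<ge> 0 then t \<ge> 0 else t \<le> 0"
    using q by (auto simp: t_def divide_le_0_iff mult_nonneg_nonpos)
  have "y - 2 / of_int q \<le> real n * x + of_int k \<and> real n * x + of_int k < y"
    unfolding eq using m t sign by (auto simp: z_def split: if_splits)
  thus ?thesis using n by blast
qed

section \<open>Covering times from convergent denominators\<close>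

lemma convergent_covering:
  assumes "B > 0" "A / B \<notin> \<rat>"
  shows "circular_gaps_le B (rotation_orbit A B (nat (cf_den (A / B) (Suc n))))
    (2 * B / of_int (cf_den (A / B) (Suc n)))"
proof -
  define q where "q = cf_den (A / B) (Suc n)"
  show ?thesis unfolding circular_gaps_le_rotation_orbit_iff[OF assms(1)] q_def[symmetric]
  proof
    fix y
    obtain m :: nat and k :: int where mk: "int m < q" "y / B - 2 / of_int q \<le> real m * (A / B) + of_int k"
      "real m * (A / B) + of_int k < y / B"
      using rational_approx_covers[OF coprime_cf, of "A / B" n] assms cf_den_bounds[of "A / B" n]
        cf_approx[of "A / B" n] unfolding q_def by blast
    have "y - 2 * B / of_int q = (y / B - 2 / of_int q) * B"
      "real m * A + of_int k * B = (real m * (A / B) + of_int k) * B" "y / B * B = y"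
      using assms(1) by (auto simp: field_simps)
    hence "y - 2 * B / of_int q \<le> real m * A + of_int k * B" "real m * A + of_int k * B < y"
      using mk mult_right_mono[OF mk(2), of B] mult_strict_right_mono[OF mk(3), of B] assms(1) by auto
    thus "\<exists>m\<le>nat q. \<exists>k::int. y - 2 * B / of_int q \<le> real m * A + of_int k * B \<and> real m * A + of_int k * B < y"
      using mk(1) by (intro exI[of _ m]) auto
  qed
qed

lemma convergent_covering_le:
  assumes "B > 0" "A / B \<notin> \<rat>" "\<delta> > 0" "2 * B / \<delta> \<le> of_int (cf_den (A / B) (Suc n))"
  shows "circular_gaps_le B (rotation_orbit A B (nat (cf_den (A / B) (Suc n)))) \<delta>"
proof -
  have "cf_den (A / B) (Suc n) \<ge> 1" using cf_den_bounds assms(2) by blast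
  hence "2 * B / of_int (cf_den (A / B) (Suc n)) \<le> \<delta>" using assms by (simp add: field_simps)
  thus ?thesis using convergent_covering[OF assms(1,2), of n]
    unfolding circular_gaps_le_rotation_orbit_iff[OF assms(1)] by (smt (verit))
qed

text \<open>The minimum is attained because the unbounded denominators supply an admissible
  index.\<close>

lemma circular_gaps_le_covering_time:
  assumes "B > 0" "A / B \<notin> \<rat>" "\<delta> > 0"
  shows "circular_gaps_le B (rotation_orbit A B (covering_time A B \<delta>)) \<delta>"
proof -
  obtain n where "2 * B / \<delta> \<le> real n" using real_arch_simple by blast
  also have "real n \<le> of_int (cf_den (A / B) (Suc n))" using cf_den_Suc_ge[OF assms(2), of n] by linarith
  finally have "circular_gaps_le B (rotation_orbit A B (nat (cf_den (A / B) (Suc n)))) \<delta>"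
    using assms by (intro convergent_covering_le) auto
  moreover have "nat (cf_den (A / B) (Suc n)) \<ge> 1" using cf_den_bounds[OF assms(2), of n] by linarith
  ultimately show ?thesis unfolding covering_time_def
    by (metis (mono_tags, lifting) LeastI)
qed

text \<open>The first denominator to reach \<open>2 * B / \<delta>\<close> bounds the covering time.
  Its predecessor is still below that value, and the ratio of the two is at most
  \<open>M + 1\<close>.\<close>

lemma covering_time_bounded_type:
  assumes "B > 0" "rotation_bounded_type A B"
  shows "\<exists>C>0. \<forall>\<delta>. 0 < \<delta> \<and> \<delta> < 2 * B \<longrightarrow> real (covering_time A B \<delta>) \<le> C * \<delta> powr (-1)"
proof -
  have irr: "A / B \<notin> \<rat>" using assms by (simp add: rotation_bounded_type_def)
  obtain M where M: "\<And>n. \<bar>partial_quotient (A / B) n\<bar> \<le> M"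
    using assms by (auto simp: rotation_bounded_type_def)
  have M0: "M \<ge> 0" using M[of 0] by linarith
  define q where "q = (\<lambda>n. cf_den (A / B) (Suc n))"
  have q_bounds: "q n \<ge> 1" for n using cf_den_bounds[OF irr] by (simp add: q_def)
  have q_Suc: "q (Suc n) \<le> (M + 1) * q n" for n
  proof -
    have "partial_quotient (A / B) (Suc n) * q n \<le> M * q n"
      using M[of "Suc n"] q_bounds[of n] by (intro mult_right_mono) auto
    thus ?thesis using cf_den_bounds[OF irr, of n]
      unfolding q_def cf_den.simps distrib_right mult_1 by linarith
  qed
  have "real (covering_time A B \<delta>) \<le> (M + 1) * (2 * B) * \<delta> powr (-1)" if \<delta>: "0 < \<delta>" "\<delta> < 2 * B" for \<delta>
  proof -
    define k where "k = (LEAST n. 2 * B / \<delta> \<le> of_int (q n))"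
    obtain n where n: "2 * B / \<delta> \<le> real n" using real_arch_simple by blast
    also have "real n \<le> of_int (q n)" using cf_den_Suc_ge[OF irr, of n] unfolding q_def by linarith
    finally have k: "2 * B / \<delta> \<le> of_int (q k)" unfolding k_def by (rule LeastI)
    \<comment> \<open>As \<open>\<delta> < 2 * B\<close>, the denominator 1 falls short of
      \<open>2 * B / \<delta>\<close>, so the least index has a predecessor.\<close>
    have "q 0 = 1" by (simp add: q_def)
    hence "k \<noteq> 0" using k \<delta> by (intro notI) (simp add: divide_le_eq)
    then obtain j where j: "k = Suc j" using not0_implies_Suc by blast
    have "\<not> 2 * B / \<delta> \<le> of_int (q j)" using not_less_Least[of j "\<lambda>n. 2 * B / \<delta> \<le> of_int (q n)"] j
      by (simp add: k_def[symmetric])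
    have "nat (q k) \<ge> 1 \<and> circular_gaps_le B (rotation_orbit A B (nat (q k))) \<delta>"
      using convergent_covering_le[OF assms(1) irr \<delta>(1)] k q_bounds[of k] by (simp add: q_def)
    hence "covering_time A B \<delta> \<le> nat (q k)" unfolding covering_time_def by (rule Least_le)
    hence "real (covering_time A B \<delta>) \<le> of_int (q k)" using q_bounds[of k] by linarith
    also have "\<dots> \<le> of_int ((M + 1) * q j)" using q_Suc[of j] unfolding j of_int_le_iff .
    also have "\<dots> = of_int (M + 1) * of_int (q j)" by simp
    also have "\<dots> \<le> of_int (M + 1) * (2 * B / \<delta>)"
      using \<open>\<not> 2 * B / \<delta> \<le> of_int (q j)\<close> M0 by (intro mult_left_mono) auto
    finally show ?thesis using \<delta> by (simp add: powr_minus_divide)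
  qed
  thus ?thesis using M0 assms(1) by (intro exI[of _ "(M + 1) * (2 * B)"]) auto
qed


section \<open>Emission times and saturation\<close>

text \<open>The state of a vertex right after an arrival. It forgets the arriving edge, so it can be
  transported along walks.\<close>

definition emits :: "'a set set \<Rightarrow> ('a set \<Rightarrow> real) \<Rightarrow> 'a \<Rightarrow> real \<Rightarrow> 'a \<Rightarrow> bool" where
  "emits E l v t u \<longleftrightarrow> (\<forall>w. {u, w} \<in> E \<longrightarrow> moving_point E l v t u w 0)"

lemma walk_length_simps [simp]:
  "walk_length l [u] = 0"
  "walk_length l (u # w # vs) = l {u, w} + walk_length l (w # vs)"
  by (simp_all add: walk_length_def sum.lessThan_Suc_shift del: sum.lessThan_Suc)

lemma walk_Cons_Cons: "walk V E (u # w # vs) \<longleftrightarrow> u \<in> V \<and> {u, w} \<in> E \<and> walk V E (w # vs)"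
  by (auto simp: walk_def)

text \<open>Among the emitted points, the one heading for the next vertex of the walk branches there
  one edge length later.\<close>

lemma emits_walk:
  assumes "emits E l v t (hd vs)" "walk V E vs"
  shows "emits E l v (t + walk_length l vs) (last vs)"
  using assms
proof (induction vs arbitrary: t rule: induct_list012)
  case (3 u w vs)
  have "emits E l v (t + l {u, w}) w"
    using 3 moving_point.branch[of E l v t u w 0]
    by (auto simp: emits_def walk_Cons_Cons)
  from "3.IH"(2)[of "t + l {u, w}"] this show ?case
    using "3.prems" by (simp add: walk_Cons_Cons add.assoc)
qed (auto simp: walk_def)

lemma emits_closed_walk:
  assumes "emits E l v t v" "closed_walk_at V E v vs"
  shows "emits E l v (t + real n * walk_length l vs) v"
proof (induction n)
  case (Suc n)
  have "emits E l v (t + real n * walk_length l vs + walk_length l vs) v"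
    using emits_walk[of E l v _ vs V] Suc assms(2)
    by (auto simp: closed_walk_at_def walk_between_def)
  thus ?case by (simp add: algebra_simps)
qed (use assms in simp)

section \<open>Distances and coordinates along edges\<close>

context finite_metric_graph
begin

lemma finite_edges: "finite E"
  using finite_vertices edges by (meson Pow_iff finite_Pow_iff finite_subset subsetI)

lemma walk_length_nonneg: "walk V E vs \<Longrightarrow> walk_length l vs \<ge> 0"
proof (induction vs rule: induct_list012)
  case (3 u w vs)
  thus ?case using length_pos[of "{u, w}"] by (auto simp: walk_Cons_Cons)
qed (auto simp: walk_def)

lemma edge_point_flip:
  assumes "{u, w} \<in> E"
  shows "edge_point l u w s = edge_point l w u (l {u, w} - s)"
proof -
  have "l {w, u} = l {u, w}" "l {u, w} > 0" using length_pos assms by (auto simp: insert_commute)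
  thus ?thesis by (auto simp: edge_point_def field_simps fun_eq_iff)
qed

text \<open>Keeps the infimum in \<open>graph_dist\<close> bounded below, so that any single path
  bounds the distance from above.\<close>

lemma path_lengths_nonneg: "d \<in> path_lengths V E l p q \<Longrightarrow> d \<ge> 0"
  using walk_length_nonneg
  by (fastforce simp: path_lengths_def segment_to_vertex_def walk_between_def)

lemma graph_dist_edge_le:
  assumes "{u, w} \<in> E" "s \<in> {0..l {u, w}}" "s' \<in> {0..l {u, w}}"
  shows "graph_dist V E l (edge_point l u w s) (edge_point l u w s') \<le> \<bar>s - s'\<bar>"
  unfolding graph_dist_def
proof (rule cInf_lower)
  show "\<bar>s - s'\<bar> \<in> path_lengths V E l (edge_point l u w s) (edge_point l u w s')"
    using assms unfolding path_lengths_def by blast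
  show "bdd_below (path_lengths V E l (edge_point l u w s) (edge_point l u w s'))"
    using path_lengths_nonneg by (meson bdd_belowI)
qed

text \<open>Measuring from the nearer endpoint leaves half an edge ahead of \<open>p\<close>, room
  for a moving point slightly further on. A vertex becomes offset 0 on an incident edge.\<close>

lemma graph_point_half_edge:
  assumes "p \<in> graph_points V E l" "\<And>u. u \<in> V \<Longrightarrow> \<exists>w. {u, w} \<in> E"
  obtains u w s where "{u, w} \<in> E" "0 \<le> s" "s \<le> l {u, w} / 2" "p = edge_point l u w s"
proof -
  consider u where "u \<in> V" "p = indicator {u}"
    | u w s where "{u, w} \<in> E" "0 \<le> s" "s \<le> l {u, w}" "p = edge_point l u w s"
    using assms(1) by (auto simp: graph_points_def)
  thus ?thesis
  proof cases
    case 1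
    then obtain w where w: "{u, w} \<in> E" using assms(2) by blast
    have "p = edge_point l u w 0" using 1 by (auto simp: edge_point_def)
    thus ?thesis using w length_pos[OF w] by (intro that[of u w 0]) auto
  next
    case 2
    show ?thesis
    proof (cases "s \<le> l {u, w} / 2")
      case True
      thus ?thesis using 2 that by blast
    next
      case False
      thus ?thesis using 2 edge_point_flip[of u w s]
        by (intro that[of w u "l {u, w} - s"]) (auto simp: insert_commute)
    qed
  qed
qed

end

lemma walk_between_edge:
  assumes "walk_between V E u vs w" "length vs > 1"
  shows "\<exists>x. {u, x} \<in> E"
  using assms by (cases vs rule: remdups_adj.cases) (auto simp: walk_between_def walk_def)

section \<open>From covering times to permanent saturation\<close>

theorem corollary3p6:
  fixes V :: "'a set" and E :: "'a set set" and l :: "'a set \<Rightarrow> real" and v :: 'a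
    and C\<^sub>1 C\<^sub>2 :: "'a list" and A B :: real
  assumes "finite_metric_graph V E l" and "graph_connected V E" and "v \<in> V"
    and "closed_walk_at V E v C\<^sub>1" and "closed_walk_at V E v C\<^sub>2"
    and "A = walk_length l C\<^sub>1" and "B = walk_length l C\<^sub>2"
    and "A / B \<notin> \<rat>"
  shows "(\<forall>C \<gamma> :: real. C > 0 \<and> \<gamma> \<ge> 1 \<longrightarrow>
            (\<exists>K>0. \<forall>\<epsilon>\<^sub>0>0.
               (\<forall>\<epsilon>. 0 < \<epsilon> \<and> \<epsilon> < \<epsilon>\<^sub>0 \<longrightarrow> real (covering_time A B \<epsilon>) \<le> C * \<epsilon> powr (- \<gamma>)) \<longrightarrow>
               (\<forall>\<^sub>F \<epsilon> in at_right 0. saturation_time V E l v \<epsilon> \<le> ereal (K * \<epsilon> powr (- \<gamma>)))))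
       \<and> (rotation_bounded_type A B \<longrightarrow>
            (\<exists>K>0. \<forall>\<^sub>F \<epsilon> in at_right 0. saturation_time V E l v \<epsilon> \<le> ereal (K * \<epsilon> powr (- 1))))"
proof -
  interpret finite_metric_graph V E l by fact
  have walks: "walk V E C\<^sub>1" "walk V E C\<^sub>2"
    using assms by (auto simp: closed_walk_at_def walk_between_def)
  have "A \<noteq> 0" "B \<noteq> 0" using assms(8) by auto
  hence A: "A > 0" and B: "B > 0"
    using walks[THEN walk_length_nonneg] assms(6,7) by auto
  \<comment> \<open>\<open>C\<^sub>1\<close> has positive length, so it provides an edge at
    \<open>v\<close>; any other vertex starts a nontrivial walk to \<open>v\<close>.\<close>
  have deg: "\<exists>w. {u, w} \<in> E" if u: "u \<in> V" for u
  proof (cases "u = v")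
    case True
    have "length C\<^sub>1 > 1" using A assms(6) by (auto simp: walk_length_def intro: ccontr)
    thus ?thesis using walk_between_edge assms(4) True by (metis closed_walk_at_def)
  next
    case False
    obtain vs where vs: "walk_between V E u vs v" using assms(2,3) u by (auto simp: graph_connected_def)
    hence "length vs > 1" using False by (cases vs) (auto simp: walk_between_def walk_def)
    thus ?thesis using walk_between_edge vs by metis
  qed
  have emits0: "emits E l v 0 v" by (auto simp: emits_def moving_point.start)
  have "\<exists>d\<ge>0. \<forall>m n::nat. emits E l v (d + (real n * A + real m * B)) u" if u: "u \<in> V" for u
  proof -
    obtain vs where vs: "walk_between V E v vs u" using assms(2,3) u by (auto simp: graph_connected_def)
    have "emits E l v (walk_length l vs + (real n * A + real m * B)) u" for m n :: nat
      using emits_walk[of E l v "real n * A + real m * B" vs V] vs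
        emits_closed_walk[OF emits_closed_walk[OF emits0 assms(4)] assms(5), of n m] assms(6,7)
      by (simp add: walk_between_def add.commute)
    thus ?thesis using walk_length_nonneg[of vs] vs
      by (intro exI[of _ "walk_length l vs"]) (auto simp: walk_between_def)
  qed
  then obtain d where d: "\<And>u. u \<in> V \<Longrightarrow> d u \<ge> 0"
    "\<And>u m n. u \<in> V \<Longrightarrow> emits E l v (d u + (real n * A + real m * B)) u" by metis
  \<comment> \<open>Bounds \<open>d u + l e\<close> for all vertices and edges at once; the extra 1
    leaves room for \<open>\<epsilon> < 1\<close>.\<close>
  define D where "D = sum d V + sum l E + 1"
  have D: "d u + l e + 1 \<le> D" if "u \<in> V" "e \<in> E" for u e
  proof -
    have "d u \<le> sum d V" using that d finite_vertices by (intro member_le_sum) auto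
    moreover have "l e \<le> sum l E"
      using that finite_edges length_pos by (intro member_le_sum) (auto intro: less_imp_le)
    ultimately show ?thesis by (simp add: D_def)
  qed
  have D_pos: "D \<ge> 1"
    using sum_nonneg[of V d] sum_nonneg[of E l] d length_pos by (auto simp: D_def less_imp_le add_nonneg_nonneg)
  have small: "\<forall>\<^sub>F \<epsilon> in at_right 0. 0 < \<epsilon> \<and> \<epsilon> < 1 \<and> (\<forall>e\<in>E. 2 * \<epsilon> < l e)"
  proof -
    have "\<forall>\<^sub>F \<epsilon> in at_right 0. 2 * \<epsilon> < l e" if "e \<in> E" for e
      using eventually_at_right_less[of "0::real"] eventually_at_rightI[of 0 "l e / 2"] length_pos[OF that] by auto
    thus ?thesis using finite_edges eventually_at_right_less[of "0::real"] eventually_at_rightI[of 0 "1::real"]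
      by (auto intro!: eventually_conj eventually_ball_finite)
  qed
  have sat: "saturation_time V E l v \<epsilon> \<le> ereal (D + real (covering_time A B \<epsilon>) * A)"
    if \<epsilon>: "0 < \<epsilon>" "\<epsilon> < 1" "\<forall>e\<in>E. 2 * \<epsilon> < l e" for \<epsilon>
  proof -
    define N where "N = covering_time A B \<epsilon>"
    have cover: "\<exists>n\<le>N. \<exists>k::int. y - \<epsilon> \<le> real n * A + of_int k * B \<and> real n * A + of_int k * B < y" for y
      using circular_gaps_le_covering_time[OF B assms(8) \<epsilon>(1)]
      unfolding circular_gaps_le_rotation_orbit_iff[OF B] N_def by blast
    have "saturated_at V E l v \<epsilon> t" if t: "t \<ge> D + real N * A" for t
      unfolding saturated_at_def
    proof
      fix p assume "p \<in> graph_points V E l"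
      then obtain u w s where uw: "{u, w} \<in> E" "0 \<le> s" "s \<le> l {u, w} / 2" "p = edge_point l u w s"
        using graph_point_half_edge deg by metis
      have u: "u \<in> V" using edges uw by auto
      obtain n and k :: int where nk: "n \<le> N" "t - d u - s - \<epsilon> \<le> real n * A + of_int k * B"
        "real n * A + of_int k * B < t - d u - s" using cover by blast
      have "real n * A \<le> real N * A" using nk A by simp
      \<comment> \<open>The late time makes \<open>k\<close> a genuine number of turns around
        \<open>C\<^sub>2\<close>: what remains of \<open>t\<close> after the delay
        \<open>d u\<close>, the offset, \<epsilon> and \<open>n\<close> turns around
        \<open>C\<^sub>1\<close> is positive.\<close>
      hence "of_int k * B > 0"
        using nk(2) t D[OF u uw(1)] uw \<epsilon> length_pos[OF uw(1)] by linarith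
      hence "k > 0" using B by (simp add: zero_less_mult_iff)
      define T where "T = d u + (real n * A + of_int k * B)"
      have "emits E l v T u" using d(2)[OF u, of n "nat k"] \<open>k > 0\<close> by (simp add: T_def)
      hence start: "moving_point E l v T u w 0" using uw by (simp add: emits_def)
      have s': "s < t - T" "t - T \<le> s + \<epsilon>" using nk by (auto simp: T_def)
      \<comment> \<open>The offset is at most \<open>s + \<epsilon>\<close>, with \<open>s\<close>
        at most half the edge and \<epsilon> less than half, so the point has not yet left the
        edge.\<close>
      have L: "t - T < l {u, w}" using s' \<epsilon> uw by force
      have "moving_point E l v t u w (t - T)"
        using moving_point.move[OF start, of "t - T"] s' uw L by simp
      moreover have "graph_dist V E l p (edge_point l u w (t - T)) \<le> \<epsilon>"
        using graph_dist_edge_le[OF uw(1), of s "t - T"] s' uw L by auto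
      ultimately show "\<exists>u w s. moving_point E l v t u w s \<and> graph_dist V E l p (edge_point l u w s) \<le> \<epsilon>"
        by blast
    qed
    moreover have "D + real N * A \<ge> 0" using D_pos A by simp
    ultimately show ?thesis unfolding saturation_time_def N_def[symmetric] by (intro Inf_lower) blast
  qed
  have part1: "\<exists>K>0. \<forall>\<epsilon>\<^sub>0>0.
      (\<forall>\<epsilon>. 0 < \<epsilon> \<and> \<epsilon> < \<epsilon>\<^sub>0 \<longrightarrow> real (covering_time A B \<epsilon>) \<le> C * \<epsilon> powr (- \<gamma>)) \<longrightarrow>
      (\<forall>\<^sub>F \<epsilon> in at_right 0. saturation_time V E l v \<epsilon> \<le> ereal (K * \<epsilon> powr (- \<gamma>)))"
    if C: "C > 0" and \<gamma>: "\<gamma> \<ge> 1" for C \<gamma> :: real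
  \<comment> \<open>The constant does not involve \<open>\<epsilon>\<^sub>0\<close>. For \<epsilon>
    below 1 the power is at least 1 and absorbs the additive \<open>D\<close>.\<close>
  proof (intro exI[of _ "D + C * A"] conjI allI impI)
    show "D + C * A > 0" using D_pos C A by (simp add: add_pos_pos)
    fix \<epsilon>\<^sub>0 :: real
    assume "\<epsilon>\<^sub>0 > 0" and cov: "\<forall>\<epsilon>. 0 < \<epsilon> \<and> \<epsilon> < \<epsilon>\<^sub>0 \<longrightarrow> real (covering_time A B \<epsilon>) \<le> C * \<epsilon> powr (- \<gamma>)"
    hence "\<forall>\<^sub>F \<epsilon> in at_right 0. \<epsilon> < \<epsilon>\<^sub>0" by (auto intro: eventually_at_rightI)
    with small show "\<forall>\<^sub>F \<epsilon> in at_right 0. saturation_time V E l v \<epsilon> \<le> ereal ((D + C * A) * \<epsilon> powr (- \<gamma>))"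
    proof eventually_elim
      case (elim \<epsilon>)
      have "\<epsilon> powr (- \<gamma>) \<ge> 1" using elim \<gamma> by (simp add: powr_minus_divide powr_le1 le_divide_eq)
      hence "D \<le> D * \<epsilon> powr (- \<gamma>)" using D_pos by simp
      moreover have "real (covering_time A B \<epsilon>) * A \<le> C * \<epsilon> powr (- \<gamma>) * A"
        using cov elim A by (intro mult_right_mono) auto
      ultimately have "D + real (covering_time A B \<epsilon>) * A \<le> (D + C * A) * \<epsilon> powr (- \<gamma>)"
        by (simp add: algebra_simps)
      hence "ereal (D + real (covering_time A B \<epsilon>) * A) \<le> ereal ((D + C * A) * \<epsilon> powr (- \<gamma>))"
        by simp
      with sat[of \<epsilon>] elim show ?case using order_trans by blast
    qed
  qed
  moreover have "\<exists>K>0. \<forall>\<^sub>F \<epsilon> in at_right 0. saturation_time V E l v \<epsilon> \<le> ereal (K * \<epsilon> powr (- 1))"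
    if "rotation_bounded_type A B"
  proof -
    obtain C where "C > 0" "\<forall>\<epsilon>. 0 < \<epsilon> \<and> \<epsilon> < 2 * B \<longrightarrow> real (covering_time A B \<epsilon>) \<le> C * \<epsilon> powr (- 1)"
      using covering_time_bounded_type[OF B \<open>rotation_bounded_type A B\<close>] by blast
    moreover have "2 * B > 0" using B by simp
    \<comment> \<open>The case \<gamma> = 1, with \<open>2 * B\<close> in the role of
      \<open>\<epsilon>\<^sub>0\<close>.\<close>
    ultimately show ?thesis using part1[of C 1, OF _ order_refl] by blast
  qed
  ultimately show ?thesis by blast
qed

end
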